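(* Let $X$ be an infinite-dimensional complex Banach space, let $T\in\mathcal{B}(X)$ and let $M$ be a paracomplete subspace of $X$ such that $M\cap\mathcal{N}(T)$ is topologically complemented in $X$. If $T(M)$ is topologically complemented in $X$, then $M$ is also topologically complemented in $X$.
   Context: $\mathcal{B}(X)$ is the algebra of bounded linear operators on $X$; $\mathcal{N}(T)$ denotes the kernel of $T$. A subspace of $X$ is paracomplete if it is the range of a bounded linear operator (from some Banach space into $X$). A subspace of $X$ is topologically complemented if it is closed and has a closed algebraic complement in $X$. *)

theory Defs
  imports "HOL-Analysis.Analysis"
begin

(* The library has real Banach spaces only.  A complex Banach space is a real one with a
   complex scalar multiplication extending scaleR for which the norm is homogeneous. *)

class complex_vector = real_vector +
  fixes scaleC :: "complex \<Rightarrow> 'a \<Rightarrow> 'a"  (infixr "*\<^sub>C" 75)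
  assumes scaleC_add_right: "a *\<^sub>C (x + y) = a *\<^sub>C x + a *\<^sub>C y"
    and scaleC_add_left: "(a + b) *\<^sub>C x = a *\<^sub>C x + b *\<^sub>C x"
    and scaleC_scaleC: "a *\<^sub>C (b *\<^sub>C x) = (a * b) *\<^sub>C x"
    and scaleC_of_real: "complex_of_real r *\<^sub>C x = r *\<^sub>R x"

class complex_normed_vector = complex_vector + real_normed_vector +
  assumes norm_scaleC: "norm (a *\<^sub>C x) = cmod a * norm x"

class complex_banach = complex_normed_vector + banach

instantiation complex :: complex_banach
begin

definition scaleC_complex :: "complex \<Rightarrow> complex \<Rightarrow> complex"
  where "scaleC_complex a x = a * x"

instance
  by standard
    (simp_all add: scaleC_complex_def algebra_simps norm_mult scaleR_conv_of_real)

end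

global_interpretation complex_vector:
  vector_space "scaleC :: complex \<Rightarrow> 'a \<Rightarrow> 'a::complex_vector"
  defines csubspace = complex_vector.subspace
    and cspan = complex_vector.span
proof
  show "1 *\<^sub>C x = x" for x :: 'a
    using scaleC_of_real[of 1 x] by simp
qed (simp_all add: scaleC_add_right scaleC_add_left scaleC_scaleC)

definition infinite_cdim :: "'a::complex_vector itself \<Rightarrow> bool"
  where "infinite_cdim _ \<longleftrightarrow> \<not> (\<exists>B :: 'a set. finite B \<and> cspan B = UNIV)"

definition bounded_clinear ::
    "('a::complex_normed_vector \<Rightarrow> 'b::complex_normed_vector) \<Rightarrow> bool"
  where "bounded_clinear f \<longleftrightarrow>
    Vector_Spaces.linear scaleC scaleC f \<and> (\<exists>K. \<forall>x. norm (f x) \<le> K * norm x)"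

(* HOL cannot quantify over types inside a formula, so the Banach space that serves as the
   domain is a parameter.  In a hypothesis, leaving 'y as a type variable of the theorem
   expresses "for some Banach space": (EX Y. P Y) --> Q is ALL Y. (P Y --> Q). *)
definition paracomplete :: "'y::complex_banach itself \<Rightarrow> 'x::complex_banach set \<Rightarrow> bool"
  where "paracomplete _ M \<longleftrightarrow> (\<exists>S :: 'y \<Rightarrow> 'x. bounded_clinear S \<and> M = range S)"

definition algebraic_complement :: "'a::complex_vector set \<Rightarrow> 'a set \<Rightarrow> bool"
  where "algebraic_complement M N \<longleftrightarrow>
    csubspace N \<and> M \<inter> N = {0} \<and> {m + n | m n. m \<in> M \<and> n \<in> N} = UNIV"

definition topologically_complemented :: "'a::complex_normed_vector set \<Rightarrow> bool"
  where "topologically_complemented M \<longleftrightarrow>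
    csubspace M \<and> closed M \<and> (\<exists>N. closed N \<and> algebraic_complement M N)"

end

theory Submission
  imports Defs
begin

text \<open>
  Let \<open>K = M \<inter> {x. T x = 0}\<close>, let \<open>L\<close> be a closed complement of \<open>K\<close> and \<open>W\<close> a closed complement
  of \<open>T ` M\<close>. The closed subspace \<open>N = L \<inter> T -` W\<close> is an algebraic complement of \<open>M\<close>: a vector of
  \<open>M \<inter> N\<close> is mapped into \<open>T ` M \<inter> W = {0}\<close>, so it lies in \<open>K \<inter> L = {0}\<close>; and for any \<open>x\<close>, once
  \<open>T x = T m + w\<close> and \<open>x - m = k + l\<close>, one has \<open>T l = w\<close>, so \<open>x = (m + k) + l\<close> is a
  decomposition along \<open>M\<close> and \<open>N\<close>. This part is pure algebra (\<open>algebraic_complement_vimage\<close>).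

  What remains is that \<open>M\<close> is closed, and this is where paracompleteness enters: the range of a
  bounded operator \<open>S\<close> is closed as soon as it has a closed complement \<open>N\<close>
  (\<open>closed_range_if_closed_complement\<close>). Indeed
  \<open>(y, n) \<mapsto> S y + n\<close> maps the Banach space \<open>UNIV \<times> N\<close> onto the whole space, so by the open mapping
  theorem the \<open>N\<close>-component of a vector depends on it continuously, and the range is the set of
  vectors on which this component vanishes. HOL types cannot depend on \<open>N\<close>, so the open mapping
  theorem is proved for operators restricted to a closed subspace of a Banach space
  (\<open>preimage_bounded\<close>).
\<close>

section \<open>The open mapping theorem on a closed subspace\<close>

text \<open>
  The Baire step. The images of the bounded pieces of \<open>V\<close> cover the target space, so one of them
  is dense in some ball \<open>ball c e\<close>. Averaging an approximate preimage of \<open>c + x\<close> with the negative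
  of one of \<open>c - x\<close> moves the centre to the origin, and scaling does the rest.
\<close>

lemma approximate_preimage_bounded:
  fixes A :: "'z::real_normed_vector \<Rightarrow> 'a::banach"
  assumes A: "bounded_linear A" and V: "subspace V" and surj: "A ` V = UNIV"
  obtains C where "C > 0"
    and "\<And>x \<delta>. \<delta> > 0 \<Longrightarrow> \<exists>z\<in>V. norm z \<le> C * norm x \<and> norm (A z - x) < \<delta>"
proof -
  interpret A: bounded_linear A by (rule A)
  define F where "F n = closure (A ` (V \<inter> cball 0 (real n)))" for n
  have "x \<in> \<Union>(range F)" for x
  proof -
    obtain z where z: "z \<in> V" "A z = x"
      using surj by (metis UNIV_I imageE)
    obtain n where "norm z \<le> real n"
      using real_arch_simple by blast
    then have "x \<in> A ` (V \<inter> cball 0 (real n))"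
      using z by auto
    then have "x \<in> F n"
      unfolding F_def by (rule subsetD[OF closure_subset])
    then show ?thesis by blast
  qed
  then have "\<Union>(range F) = UNIV" by blast
  then have "euclidean interior_of \<Union>(range F) \<noteq> {}" by simp
  moreover have "completely_metrizable_space (euclidean :: 'a topology)"
    by (rule completely_metrizable_space_euclidean)
  moreover have "closedin euclidean (F n)" for n by (simp add: F_def)
  ultimately have "\<exists>n. euclidean interior_of F n \<noteq> {}"
    using Baire_category_alt[of euclidean "range F"] by (metis countableI_type countable_image imageE)
  then obtain n where "euclidean interior_of F n \<noteq> {}" ..
  then obtain c where "c \<in> interior (F n)" by auto
  then obtain e where e: "e > 0" "ball c e \<subseteq> F n"
    using mem_interior by blast
  \<comment> \<open>A vector \<open>x\<close> is scaled to norm \<open>e / 2\<close>, hence the factor \<open>2 / e\<close>; \<open>n\<close> may be \<open>0\<close>.\<close>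
  define C where "C = 2 * (real n + 1) / e"
  have "C > 0" using e by (simp add: C_def)
  have near_c: "\<exists>u\<in>V. norm u \<le> real n \<and> norm (A u - p) < \<delta>" if "p \<in> ball c e" "\<delta> > 0" for p \<delta>
  proof -
    have "p \<in> closure (A ` (V \<inter> cball 0 (real n)))" using e(2) that by (auto simp: F_def)
    then show ?thesis
      using that(2) by (fastforce simp: closure_approachable dist_norm)
  qed
  have near_0: "\<exists>u\<in>V. norm u \<le> real n \<and> norm (A u - p) < \<delta>" if p: "norm p < e" and "\<delta> > 0" for p \<delta>
  proof -
    have "c + p \<in> ball c e" "c - p \<in> ball c e"
      using p by (auto simp: dist_norm)
    with near_c[OF _ \<open>\<delta> > 0\<close>] obtain u v where u: "u \<in> V" "norm u \<le> real n" "norm (A u - (c + p)) < \<delta>"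
      and v: "v \<in> V" "norm v \<le> real n" "norm (A v - (c - p)) < \<delta>" by metis
    define w where "w = (1/2) *\<^sub>R (u - v)"
    have "w \<in> V" unfolding w_def using V u v by (intro subspace_scale subspace_diff)
    moreover have "norm w \<le> real n"
      using norm_triangle_ineq4[of u v] u v by (simp add: w_def)
    moreover have "norm (A w - p) < \<delta>"
    proof -
      have "A u - (c + p) - (A v - (c - p)) = (A u - A v) - (p + p)" by simp
      then have "A w - p = (1/2) *\<^sub>R ((A u - (c + p)) - (A v - (c - p)))"
        unfolding w_def A.scaleR A.diff
        by (simp only: scaleR_diff_right[of _ "A u - A v"] scaleR_half_double)
      then show ?thesis
        using norm_triangle_ineq4[of "A u - (c + p)" "A v - (c - p)"] u v by simp
    qed
    ultimately show ?thesis by blast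
  qed
  have "\<exists>z\<in>V. norm z \<le> C * norm x \<and> norm (A z - x) < \<delta>" if "\<delta> > 0" for x \<delta>
  proof (cases "x = 0")
    case True
    then show ?thesis using subspace_0[OF V] \<open>\<delta> > 0\<close> by (intro bexI[of _ 0]) (auto simp: A.zero)
  next
    case False
    define t where "t = 2 * norm x / e"
    have t: "t > 0" using False e by (simp add: t_def)
    have "norm (x /\<^sub>R t) < e" using False e by (simp add: t_def)
    then obtain u where u: "u \<in> V" "norm u \<le> real n" "norm (A u - x /\<^sub>R t) < \<delta> / t"
      using near_0[of "x /\<^sub>R t" "\<delta> / t"] t \<open>\<delta> > 0\<close> by auto
    have "A (t *\<^sub>R u) - x = t *\<^sub>R (A u - x /\<^sub>R t)"
      using t by (simp add: A.scaleR scaleR_diff_right)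
    then have "norm (A (t *\<^sub>R u) - x) < \<delta>"
      using u(3) t by (simp only: norm_scaleR) (simp add: pos_less_divide_eq mult.commute)
    moreover have "norm (t *\<^sub>R u) \<le> C * norm x"
    proof -
      have "norm (t *\<^sub>R u) \<le> t * (real n + 1)"
        using t u(2) by simp
      also have "\<dots> = C * norm x" by (simp add: t_def C_def)
      finally show ?thesis .
    qed
    ultimately show ?thesis
      using subspace_scale[OF V u(1)] by blast
  qed
  with \<open>C > 0\<close> show ?thesis by (rule that)
qed

text \<open>
  Successive approximation: applying the previous lemma to the remaining error, halved each time,
  gives a geometrically convergent series of vectors of \<open>V\<close> whose sum is an exact preimage.
  Closedness of \<open>V\<close> keeps the sum in \<open>V\<close>.
\<close>

lemma preimage_bounded:
  fixes A :: "'z::banach \<Rightarrow> 'a::banach"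
  assumes A: "bounded_linear A" and V: "subspace V" "closed V" and surj: "A ` V = UNIV"
  obtains C where "C > 0" and "\<And>x. \<exists>z\<in>V. A z = x \<and> norm z \<le> C * norm x"
proof -
  interpret A: bounded_linear A by (rule A)
  obtain C where "C > 0"
    and C: "\<And>x \<delta>. \<delta> > 0 \<Longrightarrow> \<exists>z\<in>V. norm z \<le> C * norm x \<and> norm (A z - x) < \<delta>"
    using approximate_preimage_bounded[OF A V(1) surj] by blast
  have "\<exists>z\<in>V. norm z \<le> C * norm x \<and> norm (x - A z) \<le> norm x / 2" for x
  proof (cases "x = 0")
    case True
    then show ?thesis using subspace_0[OF V(1)] by (intro bexI[of _ 0]) (auto simp: A.zero)
  next
    case False
    then show ?thesis using C[of "norm x / 2" x] by (force simp: norm_minus_commute)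
  qed
  then obtain g where g: "\<And>x. g x \<in> V" "\<And>x. norm (g x) \<le> C * norm x"
      "\<And>x. norm (x - A (g x)) \<le> norm x / 2"
    by metis
  have "\<exists>z\<in>V. A z = x \<and> norm z \<le> (2 * C) * norm x" for x
  proof -
    define r where "r n = ((\<lambda>y. y - A (g y)) ^^ n) x" for n
    have r_Suc: "r (Suc n) = r n - A (g (r n))" for n by (simp add: r_def)
    have r_le: "norm (r n) \<le> norm x * (1/2) ^ n" for n
    proof (induction n)
      case (Suc n)
      then show ?case using g(3)[of "r n"] by (simp add: r_Suc)
    qed (simp add: r_def)
    define f where "f n = g (r n)" for n
    define b where "b n = C * norm x * (1/2) ^ n" for n :: nat
    have f_le: "norm (f n) \<le> b n" for n
      using order_trans[OF g(2) mult_left_mono[OF r_le]] \<open>C > 0\<close>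
      by (simp add: f_def b_def mult.assoc)
    have b: "b sums (C * norm x * 2)"
      unfolding b_def using geometric_sums[of "1/2 :: real"] by (intro sums_mult) simp
    have "summable f"
      by (rule summable_comparison_test'[OF sums_summable[OF b]]) (rule f_le)
    then have lim: "(\<lambda>n. \<Sum>i<n. f i) \<longlonglongrightarrow> suminf f"
      by (rule summable_LIMSEQ)
    have "(\<Sum>i<n. f i) \<in> V" for n
      by (intro subspace_sum V(1)) (simp add: f_def g(1))
    then have "suminf f \<in> V"
      using closed_sequentially[OF V(2) _ lim] by simp
    moreover have "norm (suminf f) \<le> (2 * C) * norm x"
      using norm_suminf_le[OF f_le sums_summable[OF b]] sums_unique[OF b] by simp
    moreover have "A (suminf f) = x"
    proof (rule LIMSEQ_unique)
      show "(\<lambda>n. A (\<Sum>i<n. f i)) \<longlonglongrightarrow> A (suminf f)" by (rule A.tendsto[OF lim])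
      have partial: "A (\<Sum>i<n. f i) = x - r n" for n
        by (induction n) (simp_all add: A.zero A.add r_Suc f_def, simp add: r_def)
      have "(\<lambda>n. norm x * (1/2) ^ n) \<longlonglongrightarrow> 0"
        by (intro tendsto_mult_right_zero LIMSEQ_power_zero) simp
      then have "r \<longlonglongrightarrow> 0"
        by (rule Lim_null_comparison[rotated]) (simp add: r_le)
      then show "(\<lambda>n. A (\<Sum>i<n. f i)) \<longlonglongrightarrow> x"
        unfolding partial using tendsto_diff[OF tendsto_const] by fastforce
    qed
    ultimately show ?thesis by blast
  qed
  with \<open>C > 0\<close> show ?thesis using that[of "2 * C"] by simp
qed

section \<open>Operator ranges with a closed complement\<close>

text \<open>
  For \<open>x\<close> in the closure, the vectors \<open>x - S y'\<close> can be made arbitrarily small while all of them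
  have the same \<open>N\<close>-component as \<open>x\<close>. The open mapping theorem bounds this component by a multiple
  of \<open>norm (x - S y')\<close>, so it vanishes.
\<close>

lemma closed_range_if_closed_complement:
  fixes S :: "'y::banach \<Rightarrow> 'a::banach"
  assumes S: "bounded_linear S" and N: "subspace N" "closed N"
    and inter: "range S \<inter> N = {0}" and sum: "\<And>x. \<exists>y. \<exists>n\<in>N. x = S y + n"
  shows "closed (range S)"
proof -
  interpret S: bounded_linear S by (fact S)
  define A where "A p = S (fst p) + snd p" for p :: "'y \<times> 'a"
  have "bounded_linear A"
    unfolding A_def
    by (intro bounded_linear_add bounded_linear_compose[OF S] bounded_linear_fst bounded_linear_snd)
  moreover have "subspace (UNIV \<times> N)"
    using N(1) by (intro subspace_Times) auto
  moreover have "closed (UNIV \<times> N)"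
    using N(2) by (intro closed_Times) auto
  moreover have "A ` (UNIV \<times> N) = UNIV"
  proof -
    have "x \<in> A ` (UNIV \<times> N)" for x
    proof -
      obtain y n where "n \<in> N" "x = S y + n" using sum by blast
      then show ?thesis by (intro image_eqI[of _ _ "(y, n)"]) (auto simp: A_def)
    qed
    then show ?thesis by blast
  qed
  ultimately obtain C where "C > 0"
    and C: "\<And>x. \<exists>z\<in>UNIV \<times> N. A z = x \<and> norm z \<le> C * norm x"
    by (rule preimage_bounded) blast
  have "x \<in> range S" if "x \<in> closure (range S)" for x
  proof -
    obtain y n where n: "n \<in> N" and x: "x = S y + n" using sum by blast
    have "norm n \<le> \<epsilon>" if "\<epsilon> > 0" for \<epsilon>
    proof -
      obtain y' where y': "norm (S y' - x) < \<epsilon> / C"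
        using \<open>x \<in> closure (range S)\<close> \<open>C > 0\<close> \<open>\<epsilon> > 0\<close>
        by (fastforce simp: closure_approachable dist_norm)
      obtain y'' n'' where n'': "n'' \<in> N" and eq: "S y'' + n'' = x - S y'"
        and le: "norm (y'', n'') \<le> C * norm (x - S y')"
        using C[of "x - S y'"] by (auto simp: A_def)
      \<comment> \<open>Subtracting \<open>S y'\<close> changes \<open>x\<close> within the range only, so its \<open>N\<close>-component stays \<open>n\<close>.\<close>
      have "n - n'' = S (y'' + y' - y)"
        using eq x by (simp add: S.add S.diff algebra_simps)
      then have "n - n'' \<in> range S \<inter> N"
        using subspace_diff[OF N(1) n n''] by auto
      then have "n = n''" using inter by auto
      then have "norm n \<le> C * norm (x - S y')"
        using le norm_snd_le[of n'' y''] by simp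
      also have "\<dots> \<le> \<epsilon>"
        using y' \<open>C > 0\<close> by (simp add: norm_minus_commute field_simps)
      finally show ?thesis .
    qed
    then have "norm n \<le> 0" by (rule field_le_epsilon) simp
    then show ?thesis using x by simp
  qed
  then have "closure (range S) \<subseteq> range S" by (rule subsetI)
  then show ?thesis by (simp only: closure_subset_eq)
qed

section \<open>Complements of a subspace and of its image\<close>

lemma csubspace_imp_subspace:
  fixes V :: "'a::complex_vector set"
  assumes "csubspace V"
  shows "subspace V"
proof (rule subspaceI)
  show "r *\<^sub>R x \<in> V" if "x \<in> V" for r x
    using complex_vector.subspace_scale[OF assms that, of "complex_of_real r"]
    by (simp only: scaleC_of_real)
qed (use complex_vector.subspace_0[OF assms] complex_vector.subspace_add[OF assms] in blast)+

lemma bounded_clinear_imp_bounded_linear: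
  assumes "bounded_clinear f"
  shows "bounded_linear f"
proof -
  from assms have lin: "Vector_Spaces.linear scaleC scaleC f"
    and bd: "\<exists>K. \<forall>x. norm (f x) \<le> K * norm x"
    by (auto simp: bounded_clinear_def)
  interpret f: Vector_Spaces.linear scaleC scaleC f by (rule lin)
  from bd obtain K where "\<And>x. norm (f x) \<le> K * norm x" by blast
  then have "norm (f x) \<le> norm x * K" for x by (simp only: mult.commute)
  moreover have "f (r *\<^sub>R x) = r *\<^sub>R f x" for r x
    using f.scale[of "complex_of_real r" x] by (simp only: scaleC_of_real)
  ultimately show ?thesis
    by (intro bounded_linear_intro[where K = K] f.add)
qed

lemma algebraic_complement_vimage:
  fixes T :: "'a::complex_vector \<Rightarrow> 'b::complex_vector"
  assumes T: "Vector_Spaces.linear scaleC scaleC T" and M: "csubspace M"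
    and L: "algebraic_complement (M \<inter> {x. T x = 0}) L"
    and W: "algebraic_complement (T ` M) W"
  shows "algebraic_complement M (L \<inter> T -` W)"
proof -
  interpret T: Vector_Spaces.linear scaleC scaleC T by (rule T)
  have L': "csubspace L" "M \<inter> {x. T x = 0} \<inter> L = {0}"
      "{m + n |m n. m \<in> M \<inter> {x. T x = 0} \<and> n \<in> L} = UNIV"
    and W': "csubspace W" "T ` M \<inter> W = {0}" "{m + n |m n. m \<in> T ` M \<and> n \<in> W} = UNIV"
    using L W by (auto simp: algebraic_complement_def)
  have N: "csubspace (L \<inter> T -` W)"
    using L'(1) W'(1) by (auto simp: complex_vector.subspace_def T.add T.scale T.zero)
  moreover have "M \<inter> (L \<inter> T -` W) = {0}"
  proof -
    have "x = 0" if "x \<in> M" "x \<in> L" "T x \<in> W" for x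
    proof -
      have "T x = 0" using that W'(2) by blast
      then show ?thesis using that L'(2) by blast
    qed
    then show ?thesis
      using complex_vector.subspace_0[OF M] complex_vector.subspace_0[OF N] by blast
  qed
  moreover have "x \<in> {m + n |m n. m \<in> M \<and> n \<in> L \<inter> T -` W}" for x
  proof -
    have "T x \<in> {m + n |m n. m \<in> T ` M \<and> n \<in> W}" using W'(3) by blast
    then obtain m w where m: "m \<in> M" and w: "w \<in> W" "T x = T m + w" by blast
    have "x - m \<in> {m + n |m n. m \<in> M \<inter> {x. T x = 0} \<and> n \<in> L}" using L'(3) by blast
    then obtain k l where k: "k \<in> M" "T k = 0" and l: "l \<in> L" "x - m = k + l" by blast
    have "l = x - m - k" using l(2) by simp
    then have "T l = w" using w(2) k(2) by (simp add: T.diff)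
    moreover have "x = (m + k) + l" using l(2) by (simp add: algebra_simps)
    moreover have "m + k \<in> M" using complex_vector.subspace_add[OF M m k(1)] .
    ultimately show ?thesis using l(1) w(1) by blast
  qed
  ultimately show ?thesis unfolding algebraic_complement_def by blast
qed

theorem lemma3p3:
  fixes T :: "'x::complex_banach \<Rightarrow> 'x" and M :: "'x set"
  assumes "infinite_cdim TYPE('x)"
    and "bounded_clinear T"
    and "paracomplete TYPE('y::complex_banach) M"
    and "topologically_complemented (M \<inter> {x. T x = 0})"
    and "topologically_complemented (T ` M)"
  shows "topologically_complemented M"
proof -
  obtain S :: "'y \<Rightarrow> 'x" where S: "bounded_clinear S" and M_eq: "M = range S"
    using assms(3) by (auto simp: paracomplete_def)
  interpret S: Vector_Spaces.linear scaleC scaleC S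
    using S by (simp add: bounded_clinear_def)
  have M: "csubspace M"
    unfolding M_eq
  proof (rule complex_vector.subspaceI)
    show "0 \<in> range S" using S.zero by (metis rangeI)
    show "x + y \<in> range S" if "x \<in> range S" "y \<in> range S" for x y
    proof -
      from that obtain a b where "x = S a" "y = S b" by blast
      then have "x + y = S (a + b)" by (simp only: S.add)
      then show ?thesis by (rule range_eqI)
    qed
    show "c *\<^sub>C x \<in> range S" if "x \<in> range S" for c x
    proof -
      from that obtain a where "x = S a" by blast
      then have "c *\<^sub>C x = S (c *\<^sub>C a)" by (simp only: S.scale)
      then show ?thesis by (rule range_eqI)
    qed
  qed
  obtain L where L: "closed L" "algebraic_complement (M \<inter> {x. T x = 0}) L"
    using assms(4) by (auto simp: topologically_complemented_def)
  obtain W where W: "closed W" "algebraic_complement (T ` M) W"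
    using assms(5) by (auto simp: topologically_complemented_def)
  define N where "N = L \<inter> T -` W"
  have N: "algebraic_complement M N"
    unfolding N_def using assms(2) M L(2) W(2)
    by (intro algebraic_complement_vimage) (auto simp: bounded_clinear_def)
  have "closed (T -` W)"
    using bounded_clinear_imp_bounded_linear[OF assms(2)] W(1)
    by (intro continuous_closed_vimage) (auto intro: linear_continuous_at)
  then have N_closed: "closed N"
    unfolding N_def using L(1) by (intro closed_Int)
  have "closed M"
    unfolding M_eq
  proof (rule closed_range_if_closed_complement)
    show "bounded_linear S" by (rule bounded_clinear_imp_bounded_linear[OF S])
    show "subspace N" using N by (auto simp: algebraic_complement_def intro: csubspace_imp_subspace)
    show "closed N" by (rule N_closed)
    show "range S \<inter> N = {0}" using N by (simp add: algebraic_complement_def M_eq)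
    show "\<exists>y. \<exists>n\<in>N. x = S y + n" for x
    proof -
      have "x \<in> {m + n |m n. m \<in> M \<and> n \<in> N}"
        using N by (simp add: algebraic_complement_def)
      then show ?thesis by (auto simp: M_eq)
    qed
  qed
  then show ?thesis
    unfolding topologically_complemented_def using M N N_closed by blast
qed

end
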